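(* Let $\mathcal{G}$ be a finite quiver (self-loops allowed, at most one directed edge from any vertex to any other vertex). For any vertices $\nu_0,\nu_p$, $$W_{\mathcal{G};\nu_0\nu_p}=\bigcup_{(\nu_0\nu_1\cdots\nu_{p-1}\nu_p)\in\Pi_{\mathcal{G};\nu_0\nu_p}}\bigg(\Big(\big(\{(\nu_0\nu_1\cdots\nu_p)\}\odot A^\ast_{\mathcal{G}\setminus\{\nu_0,\dots,\nu_{p-1}\};\nu_p}\big)\odot\cdots\odot A^\ast_{\mathcal{G}\setminus\{\nu_0\};\nu_1}\Big)\odot A^\ast_{\mathcal{G};\nu_0}\bigg),$$ where for any quiver $\mathcal{H}$ (here always an induced subquiver of $\mathcal{G}$) and vertex $\mu_c$ of $\mathcal{H}$, the set $A_{\mathcal{H};\mu_c}$ is given recursively by $$A_{\mathcal{H};\mu_c}=\bigcup_{(\mu_c\mu_1\cdots\mu_{c-1}\mu_c)\in\Gamma_{\mathcal{H};\mu_c}}\bigg(\Big(\big(\{(\mu_c\mu_1\cdots\mu_{c-1}\mu_c)\}\odot A^\ast_{\mathcal{H}\setminus\{\mu_c,\mu_1,\dots,\mu_{c-2}\};\mu_{c-1}}\big)\odot\cdots\odot A^\ast_{\mathcal{H}\setminus\{\mu_c,\mu_1\};\mu_2}\Big)\odot A^\ast_{\mathcal{H}\setminus\{\mu_c\};\mu_1}\bigg),$$ the recursion terminating at a vertex $\mu$ with no neighbour in the current subquiver $\mathcal{H}'$, where $A_{\mathcal{H}';\mu}=\{(\mu\mu)\}$ if the loop $(\mu\mu)$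 exists and $A_{\mathcal{H}';\mu}=\{(\mu)\}$ otherwise. In particular, for $\nu_0=\nu_p$ one has $\Pi_{\mathcal{G};\nu_0\nu_0}=\{(\nu_0)\}$ and $W_{\mathcal{G};\nu_0\nu_0}=A^\ast_{\mathcal{G};\nu_0}$. These relations give the canonical factorization of the set $W_{\mathcal{G}}$ of all walks.
   Context: A walk of length $n\ge1$ is a sequence of contiguous edges $(\mu_0\mu_1)\cdots(\mu_{n-1}\mu_n)$ with vertex string $(\mu_0\cdots\mu_n)$; each vertex $\mu$ has a trivial walk $(\mu)$ of length $0$. A cycle (off $\mu_0$) has $\mu_0=\mu_n$; otherwise the walk is open. $W_{\mathcal{G};\alpha\omega}$ is the set of all walks from $\alpha$ to $\omega$ (including the trivial walk if $\alpha=\omega$). A simple path is an open walk whose vertices are all distinct; $\Pi_{\mathcal{G};\alpha\omega}$ is the set of simple paths from $\alpha$ to $\omega$ (for $\alpha=\omega$ it is $\{(\alpha)\}$). A simple cycle is a cycle whose internal vertices are all distinct and different from its initial vertex; $\Gamma_{\mathcal{G};\alpha}$ is the set of simple cycles off $\alpha$, including the trivial walk $(\alpha)$ and the loop $(\alpha\alpha)$ if present. $\mathcal{G}\setminus\{\alpha,\beta,\dots\}$ denotes the quiver obtained by deleting these vertices and all incident edges. Canonical couple: let $b$ be a cycle off $\beta$ and $a=(\alpha_1\cdots\alpha_k)$ a walk visiting $\beta$, with $\alpha_j=\beta$ its last appearance of $\beta$; $(a,b)$ is canonical iff (i) $a,b$ are both cycles off $\beta$, or (ii) no vertex $\alpha_i\neq\beta$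 with $i<j$ is visited by $b$. Nesting product: for canonical $(w_1,w_2)$ with $w_2$ a cycle off $\beta$, $w_1\odot w_2$ is obtained by replacing the last appearance of $\beta$ in the vertex string of $w_1$ by the whole vertex string of $w_2$; otherwise $w\odot w'=0$. For sets of walks $A,B$, $A\odot B$ is the set obtained by nesting every element of $B$ into every element of $A$ (discarding zeros). For $E\subseteq W_{\mathcal{G};\alpha\alpha}$, the Kleene star is $E^\ast=\bigcup_{i\ge0}E^i$ with $E^0=\{(\alpha)\}$ and $E^i=E^{i-1}\circ E$ (concatenation, which coincides with nesting for cycles off the same vertex). *)

theory Defs
  imports "Graph_Theory.Graph_Theory"
begin

text \<open>
  Walks are represented by their vertex strings (\<open>vwalk\<close>); in a digraph without parallel arcs
  the vertex string determines the edge sequence. A one-element list is a trivial walk.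
\<close>

definition all_walks :: "('a,'b) pre_digraph \<Rightarrow> 'a vwalk set" where
  "all_walks G = {w. vwalk w G}"

definition walks :: "('a,'b) pre_digraph \<Rightarrow> 'a \<Rightarrow> 'a \<Rightarrow> 'a vwalk set" where
  "walks G \<alpha> \<omega> = {w. vwalk w G \<and> hd w = \<alpha> \<and> last w = \<omega>}"

text \<open>
  A walk with pairwise distinct vertices is either open or trivial, so the following contains the
  simple (open) paths if \<open>\<alpha> \<noteq> \<omega>\<close> and only the trivial walk if \<open>\<alpha> = \<omega>\<close>.
\<close>

definition simple_paths :: "('a,'b) pre_digraph \<Rightarrow> 'a \<Rightarrow> 'a \<Rightarrow> 'a vwalk set" where
  "simple_paths G \<alpha> \<omega> = {w \<in> walks G \<alpha> \<omega>. vpath w G}"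

text \<open>
  For a nontrivial cycle, \<open>butlast w\<close> lists the initial vertex followed by the internal vertices.
  The trivial walk \<open>[\<alpha>]\<close> and a loop \<open>[\<alpha>, \<alpha>]\<close> are included.
\<close>

definition simple_cycles :: "('a,'b) pre_digraph \<Rightarrow> 'a \<Rightarrow> 'a vwalk set" where
  "simple_cycles G \<alpha> = {w \<in> walks G \<alpha> \<alpha>. distinct (butlast w)}"

definition delete_verts :: "('a,'b) pre_digraph \<Rightarrow> 'a set \<Rightarrow> ('a,'b) pre_digraph" where
  "delete_verts G S = G \<restriction> (verts G - S)"

definition cycle_off :: "'a \<Rightarrow> 'a vwalk \<Rightarrow> bool" where
  "cycle_off \<beta> w \<longleftrightarrow> w \<noteq> [] \<and> hd w = \<beta> \<and> last w = \<beta>"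

definition last_visit :: "'a vwalk \<Rightarrow> 'a \<Rightarrow> nat" where
  "last_visit w \<beta> = (GREATEST j. j < length w \<and> w ! j = \<beta>)"

definition canonical :: "'a vwalk \<Rightarrow> 'a vwalk \<Rightarrow> bool" where
  "canonical a b \<longleftrightarrow> (\<exists>\<beta>. cycle_off \<beta> b \<and> \<beta> \<in> set a \<and>
     (cycle_off \<beta> a \<or> (\<forall>i < last_visit a \<beta>. a ! i \<noteq> \<beta> \<longrightarrow> a ! i \<notin> set b)))"

text \<open>The zero walk, i.e. the value of a vanishing nesting product, is \<open>None\<close>.\<close>

definition nest :: "'a vwalk \<Rightarrow> 'a vwalk \<Rightarrow> 'a vwalk option" where
  "nest a b =
     (if canonical a b
      then Some (take (last_visit a (hd b)) a @ b @ drop (Suc (last_visit a (hd b))) a)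
      else None)"

definition nest_sets :: "'a vwalk set \<Rightarrow> 'a vwalk set \<Rightarrow> 'a vwalk set" (infixl \<open>\<odot>\<close> 70) where
  "A \<odot> B = {c. \<exists>a\<in>A. \<exists>b\<in>B. nest a b = Some c}"

definition concat_sets :: "'a vwalk set \<Rightarrow> 'a vwalk set \<Rightarrow> 'a vwalk set" where
  "concat_sets A B = {vwalk_join a b | a b. a \<in> A \<and> b \<in> B \<and> joinable a b}"

primrec walk_power :: "'a \<Rightarrow> 'a vwalk set \<Rightarrow> nat \<Rightarrow> 'a vwalk set" where
  "walk_power \<alpha> E 0 = {[\<alpha>]}"
| "walk_power \<alpha> E (Suc i) = concat_sets (walk_power \<alpha> E i) E"

definition kleene_star :: "'a \<Rightarrow> 'a vwalk set \<Rightarrow> 'a vwalk set" where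
  "kleene_star \<alpha> E = (\<Union>i. walk_power \<alpha> E i)"

definition no_neighbour :: "('a,'b) pre_digraph \<Rightarrow> 'a \<Rightarrow> bool" where
  "no_neighbour G \<mu> \<longleftrightarrow>
     (\<forall>\<nu> \<in> verts G. \<nu> \<noteq> \<mu> \<longrightarrow> (\<mu>, \<nu>) \<notin> arcs_ends G \<and> (\<nu>, \<mu>) \<notin> arcs_ends G)"

text \<open>
  The sets \<open>A\<^bsub>H;\<mu>\<^esub>\<close>. For a simple cycle \<open>w = [\<mu>\<^sub>c, \<mu>\<^sub>1, \<dots>, \<mu>\<^sub>c\<^sub>-\<^sub>1, \<mu>\<^sub>c]\<close> the index \<open>i\<close> runs over the
  internal positions \<open>1, \<dots>, c - 1\<close> of \<open>w\<close>; the right fold performs the nesting at \<open>i = c - 1\<close>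
  first (innermost) and the one at \<open>i = 1\<close> last. The vertices in front of position \<open>i\<close> are deleted.
  Only finite quivers matter; the value on infinite ones is a dummy that makes the function total.
\<close>

function A_set :: "('a,'b) pre_digraph \<Rightarrow> 'a \<Rightarrow> 'a vwalk set" where
  "A_set H \<mu> =
     (if infinite (verts H) then {}
      else if no_neighbour H \<mu> then (if (\<mu>, \<mu>) \<in> arcs_ends H then {[\<mu>, \<mu>]} else {[\<mu>]})
      else (\<Union>w \<in> simple_cycles H \<mu>.
        foldr (\<lambda>i S. S \<odot> kleene_star (w ! i) (A_set (delete_verts H (set (take i w))) (w ! i)))
          [1..<length w - 1] {w}))"
  by pat_completeness auto
termination
proof (relation "measure (\<lambda>(H, _). card (verts H))", goal_cases)
  case 1
  show ?case by simp
next
  case (2 H \<mu> w S i)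
  then have "w \<noteq> []" "set w \<subseteq> verts H" "0 < i"
    by (auto simp: simple_cycles_def walks_def vwalk_def)
  then have "hd w \<in> set (take i w)" "hd w \<in> verts H"
    by (cases w; cases i; auto)+
  with 2 have "verts H - set (take i w) \<subset> verts H" "finite (verts H)"
    by auto
  then show ?case
    by (simp add: delete_verts_def psubset_card_mono)
qed

declare A_set.simps [simp del]

text \<open>
  The walks obtained from a simple path \<open>[\<nu>\<^sub>0, \<dots>, \<nu>\<^sub>p]\<close> by nesting at \<open>\<nu>\<^sub>p\<close> first and at \<open>\<nu>\<^sub>0\<close> last.
\<close>

definition path_product :: "('a,'b) pre_digraph \<Rightarrow> 'a vwalk \<Rightarrow> 'a vwalk set" where
  "path_product G w =
     foldr (\<lambda>i S. S \<odot> kleene_star (w ! i) (A_set (delete_verts G (set (take i w))) (w ! i)))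
       [0..<length w] {w}"

end

theory Submission
  imports Defs
begin

text \<open>
  Cutting a walk from \<open>\<alpha>\<close> at its last visit to \<open>\<alpha>\<close> leaves a cycle off \<open>\<alpha>\<close> followed by a walk that
  avoids \<open>\<alpha>\<close>. Iterating this in the quiver without \<open>\<alpha>\<close> peels off a simple path whose \<open>i\<close>-th vertex
  carries a cycle avoiding all earlier ones, and these cycles are precisely what the nesting products
  insert. Applied to a cycle that returns to its base point only at the end, the same decomposition
  yields a simple cycle; as every cycle is a concatenation of such first-return cycles,
  \<open>A\<^bsub>H;\<mu>\<^esub>\<close> generates all cycles off \<open>\<mu>\<close>, by induction on the number of vertices.
\<close>

section \<open>Concatenation of walks and deletion of vertices\<close>

lemma vwalk_append_iff:
  assumes "p \<noteq> []" "q \<noteq> []"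
  shows "vwalk (p @ q) G \<longleftrightarrow> vwalk p G \<and> vwalk q G \<and> (last p, hd q) \<in> arcs_ends G"
  using assms by (auto simp: vwalk_def vwalk_arcs_append)

lemma vwalk_Cons_iff:
  assumes "p \<noteq> []"
  shows "vwalk (a # p) G \<longleftrightarrow> a \<in> verts G \<and> vwalk p G \<and> (a, hd p) \<in> arcs_ends G"
  using vwalk_append_iff[of "[a]" p] assms by simp

text \<open>An induced subquiver keeps every arc between surviving vertices. As a simp rule this
  turns statements about subquivers into statements about \<open>G\<close> with an avoidance
  condition.\<close>

lemma vwalk_delete_verts [simp]:
  "vwalk w (delete_verts G S) \<longleftrightarrow> vwalk w G \<and> set w \<inter> S = {}"
proof -
  have verts: "verts (delete_verts G S) = verts G - S"
    by (simp add: delete_verts_def)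
  have arcs: "arcs_ends (delete_verts G S) = {(a, b) \<in> arcs_ends G. a \<in> verts G - S \<and> b \<in> verts G - S}"
    by (auto simp: delete_verts_def arcs_ends_conv)
  show ?thesis
  proof (induction w)
    case Nil
    then show ?case by (simp add: vwalk_def)
  next
    case (Cons a w)
    show ?case
    proof (cases "w = []")
      case True
      then show ?thesis by (auto simp: verts)
    next
      case False
      then have "set w \<inter> S = {} \<Longrightarrow> hd w \<notin> S" "vwalk w G \<Longrightarrow> hd w \<in> verts G"
        using hd_in_set[OF False] by (blast, auto simp: vwalk_def)
      with False Cons.IH show ?thesis
        by (simp add: vwalk_Cons_iff verts arcs) blast
    qed
  qed
qed

lemma walks_delete_verts:
  "walks (delete_verts G S) \<alpha> \<omega> = {w \<in> walks G \<alpha> \<omega>. set w \<inter> S = {}}"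
  by (auto simp: walks_def)

lemma walks_nonempty: "w \<in> walks G \<alpha> \<omega> \<Longrightarrow> w \<noteq> []"
  by (auto simp: walks_def vwalk_def)

lemma simple_paths_delete_verts:
  "simple_paths (delete_verts G S) \<alpha> \<omega> = {w \<in> simple_paths G \<alpha> \<omega>. set w \<inter> S = {}}"
  by (auto simp: simple_paths_def walks_delete_verts vpath_def)

lemma walks_vwalk_join:
  assumes "p \<in> walks G \<alpha> \<beta>" "q \<in> walks G \<beta> \<omega>"
  shows "vwalk_join p q \<in> walks G \<alpha> \<omega>"
proof (cases "tl q = []")
  case True
  with assms have "q = [\<beta>]" "\<omega> = \<beta>" by (cases q; auto simp: walks_def vwalk_def)+
  with assms show ?thesis by (simp add: walks_def vwalk_join_def)
next
  case False
  then obtain r where r: "q = \<beta> # r" "r \<noteq> []"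
    using assms by (cases q) (auto simp: walks_def)
  moreover have "p \<noteq> []" using assms by (auto simp: walks_def vwalk_def)
  ultimately show ?thesis
    using assms by (simp add: walks_def vwalk_join_def vwalk_append_iff vwalk_Cons_iff)
qed

section \<open>Iterated nesting along a list of distinct vertices\<close>

lemma nest_at_unique_visit:
  assumes "x \<notin> set q" "cycle_off x b" "set b \<inter> set p = {}"
  shows "nest (p @ x # q) b = Some (p @ b @ q)"
proof -
  have last: "last_visit (p @ x # q) x = length p"
    unfolding last_visit_def
  proof (rule Greatest_equality)
    fix j assume j: "j < length (p @ x # q) \<and> (p @ x # q) ! j = x"
    show "j \<le> length p"
    proof (rule ccontr)
      assume "\<not> j \<le> length p"
      then obtain k where k: "j = length p + Suc k"
        using less_imp_Suc_add[of "length p" j] by auto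
      with j have "q ! k = x" "k < length q" by (auto simp: nth_append)
      with assms(1) show False by auto
    qed
  qed simp
  \<comment> \<open>Everything in front of the last visit to \<open>x\<close> lies in
    \<open>p\<close>, which \<open>b\<close> avoids, so condition (ii) of canonicity
    applies.\<close>
  have "canonical (p @ x # q) b"
    unfolding canonical_def
  proof (intro exI conjI disjI2 allI impI)
    fix i assume "i < last_visit (p @ x # q) x"
    then have "(p @ x # q) ! i \<in> set p" by (simp add: last nth_append)
    with assms(3) show "(p @ x # q) ! i \<notin> set b" by blast
  qed (use assms(2) in auto)
  moreover have "hd b = x" using assms(2) by (simp add: cycle_off_def)
  ultimately show ?thesis by (simp add: nest_def last)
qed

text \<open>An explicit form of the nested products, free of nesting, Kleene stars and the sets
  \<open>A\<close>. It mediates between walks and products; \<open>S\<close> collects the forbidden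
  vertices, to which each vertex of the list is added once its cycle has been chosen.\<close>

primrec detours :: "('a,'b) pre_digraph \<Rightarrow> 'a set \<Rightarrow> 'a list \<Rightarrow> 'a list set" where
  "detours G S [] = {[]}"
| "detours G S (x # v) =
     {c @ z | c z. c \<in> walks (delete_verts G S) x x \<and> z \<in> detours G (insert x S) v}"

lemma detours_avoid: "z \<in> detours G S v \<Longrightarrow> set z \<inter> S = {}"
proof (induction v arbitrary: S z)
  case (Cons x v)
  then show ?case by (fastforce simp: walks_delete_verts)
qed simp

text \<open>The outermost nesting of the fold takes place at the first vertex \<open>x\<close> of
  \<open>v\<close>, when the rest of \<open>v\<close> is already expanded. That expansion avoids
  \<open>x\<close>, so \<open>x\<close> is still visited only once, at position
  \<open>length u\<close>. The frame \<open>u\<close>, \<open>t\<close> is empty for simple paths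
  and consists of the two copies of the base point for simple cycles; hence \<open>t\<close> may
  share vertices with \<open>u\<close>.\<close>

lemma foldr_nest_eq_detours:
  assumes "w = u @ v @ t" "distinct (u @ v)" "set t \<inter> set v = {}"
    and "\<And>i. length u \<le> i \<Longrightarrow> i < length u + length v \<Longrightarrow>
           K i = walks (delete_verts G (set (take i w))) (w ! i) (w ! i)"
  shows "foldr (\<lambda>i S. S \<odot> K i) [length u..<length u + length v] {w}
           = (\<lambda>z. u @ z @ t) ` detours G (set u) v"
  using assms
proof (induction v arbitrary: u)
  case Nil
  then show ?case by simp
next
  case (Cons x v)
  have IH: "foldr (\<lambda>i S. S \<odot> K i) [Suc (length u)..<Suc (length u + length v)] {w}
      = (\<lambda>z. u @ x # z @ t) ` detours G (insert x (set u)) v"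
    using Cons.IH[of "u @ [x]"] Cons.prems by simp
  have K: "K (length u) = walks (delete_verts G (set u)) x x"
    using Cons.prems(4)[of "length u"] Cons.prems(1) by simp
  have nest: "nest (u @ x # z @ t) b = Some (u @ b @ z @ t)"
    if "z \<in> detours G (insert x (set u)) v" "b \<in> K (length u)" for z b
  proof (rule nest_at_unique_visit)
    show "x \<notin> set (z @ t)" using detours_avoid[OF that(1)] Cons.prems(3) by auto
    show "cycle_off x b" "set b \<inter> set u = {}"
      using that(2) by (simp_all add: K walks_delete_verts) (auto simp: walks_def cycle_off_def vwalk_def)
  qed
  have "foldr (\<lambda>i S. S \<odot> K i) [length u..<length u + length (x # v)] {w}
      = ((\<lambda>z. u @ x # z @ t) ` detours G (insert x (set u)) v) \<odot> K (length u)"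
    by (simp add: upt_conv_Cons IH del: upt_Suc)
  also have "\<dots> = {u @ b @ z @ t | b z. b \<in> K (length u) \<and> z \<in> detours G (insert x (set u)) v}"
    by (auto simp: nest_sets_def nest)
  also have "\<dots> = (\<lambda>z. u @ z @ t) ` detours G (set u) (x # v)"
    by (fastforce simp: K)
  finally show ?case .
qed

section \<open>Walks as detours of simple paths\<close>

lemma detours_subset_walks:
  assumes "vwalk v G" "set v \<inter> S = {}" "distinct v"
  shows "detours G S v \<subseteq> walks (delete_verts G S) (hd v) (last v)"
  using assms
proof (induction v arbitrary: S rule: list.induct)
  case Nil
  then show ?case by (simp add: vwalk_def)
next
  case (Cons x v)
  show ?case
  proof (cases "v = []")
    case True
    then show ?thesis by auto
  next
    case False
    show ?thesis
    proof
      fix w assume "w \<in> detours G S (x # v)"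
      then obtain c z where w: "w = c @ z" and c: "c \<in> walks (delete_verts G S) x x"
        and z: "z \<in> detours G (insert x S) v" by auto
      have "z \<in> walks (delete_verts G (insert x S)) (hd v) (last v)"
        using Cons.IH[of "insert x S"] Cons.prems False z by (auto simp: vwalk_Cons_iff)
      moreover from this c have "z \<noteq> []" "c \<noteq> []" by (simp_all add: walks_nonempty)
      ultimately show "w \<in> walks (delete_verts G S) (hd (x # v)) (last (x # v))"
        using c Cons.prems False
        by (auto simp: w walks_def vwalk_append_iff vwalk_Cons_iff)
    qed
  qed
qed

text \<open>The part after the last visit to \<alpha> is a shorter walk avoiding \<alpha>. Its
  simple path avoids \<alpha> too, so prefixing \<alpha> keeps the vertices distinct. Both
  \<open>S\<close> and the initial vertex change in the induction and are therefore
  generalised.\<close>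

lemma walks_subset_detours:
  assumes "w \<in> walks (delete_verts G S) \<alpha> \<omega>"
  shows "\<exists>v \<in> simple_paths (delete_verts G S) \<alpha> \<omega>. w \<in> detours G S v"
  using assms
proof (induction w arbitrary: S \<alpha> rule: length_induct)
  case (1 w)
  then have w: "vwalk w G" "hd w = \<alpha>" "last w = \<omega>" "set w \<inter> S = {}" "w \<noteq> []"
    by (simp_all add: walks_def walks_nonempty[OF "1.prems"])
  then have "\<alpha> \<in> set w" using hd_in_set by blast
  with w have \<alpha>: "\<alpha> \<in> verts G" "\<alpha> \<notin> S" by (auto simp: vwalk_def)
  obtain p z where pz: "w = p @ \<alpha> # z" "\<alpha> \<notin> set z"
    using split_list_last[OF \<open>\<alpha> \<in> set w\<close>] by blast
  have c: "p @ [\<alpha>] \<in> walks (delete_verts G S) \<alpha> \<alpha>"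
    using w vwalk_append_iff[of "p @ [\<alpha>]" z G] pz(1)
    by (cases "z = []"; cases p) (auto simp: walks_def)
  show ?case
  proof (cases "z = []")
    case True
    then have "\<omega> = \<alpha>" "w = p @ [\<alpha>]" using w(3) pz(1) by auto
    moreover have "[\<alpha>] \<in> simple_paths (delete_verts G S) \<alpha> \<alpha>"
      using \<alpha> by (simp add: simple_paths_def walks_def vpath_def)
    moreover have "w \<in> detours G S [\<alpha>]" using c pz(1) True by auto
    ultimately show ?thesis by blast
  next
    case False
    have z: "z \<in> walks (delete_verts G (insert \<alpha> S)) (hd z) \<omega>" "(\<alpha>, hd z) \<in> arcs_ends G"
      using w vwalk_append_iff[of "p @ [\<alpha>]" z G] pz False
      by (auto simp: walks_def)
    moreover have "length z < length w" by (simp add: pz(1))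
    ultimately obtain v where v: "v \<in> simple_paths (delete_verts G (insert \<alpha> S)) (hd z) \<omega>"
      "z \<in> detours G (insert \<alpha> S) v"
      using "1.IH" by blast
    have "\<alpha> # v \<in> simple_paths (delete_verts G S) \<alpha> \<omega>"
    proof -
      have "v \<noteq> []" using v(1) by (auto simp: simple_paths_def dest: walks_nonempty)
      then show ?thesis
        using v(1) z(2) \<alpha>
        by (auto simp: simple_paths_def walks_def vpath_def vwalk_Cons_iff)
    qed
    moreover have "w \<in> detours G S (\<alpha> # v)"
    proof -
      have "w = (p @ [\<alpha>]) @ z" by (simp add: pz(1))
      with c v(2) show ?thesis unfolding detours.simps by blast
    qed
    ultimately show ?thesis by blast
  qed
qed

lemma walks_eq_UN_detours:
  "walks (delete_verts G S) \<alpha> \<omega> = (\<Union>v \<in> simple_paths (delete_verts G S) \<alpha> \<omega>. detours G S v)"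
proof (intro equalityI subsetI)
  fix w assume "w \<in> (\<Union>v \<in> simple_paths (delete_verts G S) \<alpha> \<omega>. detours G S v)"
  then obtain v where v: "v \<in> simple_paths (delete_verts G S) \<alpha> \<omega>" "w \<in> detours G S v" by blast
  then have "vwalk v G" "set v \<inter> S = {}" "distinct v" "hd v = \<alpha>" "last v = \<omega>"
    by (simp_all add: simple_paths_def walks_def vpath_def)
  with v(2) show "w \<in> walks (delete_verts G S) \<alpha> \<omega>"
    using detours_subset_walks by blast
qed (auto dest: walks_subset_detours)

section \<open>Kleene stars and cycles off a vertex\<close>

lemma kleene_star_eq_walks:
  assumes \<mu>: "\<mu> \<in> verts G" and "E \<subseteq> walks G \<mu> \<mu>"
    and first_return: "\<And>z. \<mu> # z @ [\<mu>] \<in> walks G \<mu> \<mu> \<Longrightarrow> \<mu> \<notin> set z \<Longrightarrow> \<mu> # z @ [\<mu>] \<in> E"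
  shows "kleene_star \<mu> E = walks G \<mu> \<mu>"
proof
  have "walk_power \<mu> E i \<subseteq> walks G \<mu> \<mu>" for i
  proof (induction i)
    case 0
    then show ?case using \<mu> by (simp add: walks_def)
  next
    case (Suc i)
    with assms(2) show ?case by (auto simp: concat_sets_def intro!: walks_vwalk_join)
  qed
  then show "kleene_star \<mu> E \<subseteq> walks G \<mu> \<mu>" by (auto simp: kleene_star_def)
next
  \<comment> \<open>Powers grow on the right, so the last first-return cycle is split off and the
    shorter remaining cycle is left to the induction.\<close>
  have "\<exists>i. w \<in> walk_power \<mu> E i" if "w \<in> walks G \<mu> \<mu>" for w
    using that
  proof (induction w rule: length_induct)
    case (1 w)
    then have w: "vwalk w G" "hd w = \<mu>" "last w = \<mu>" "w \<noteq> []"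
      by (auto simp: walks_def vwalk_def)
    show ?case
    proof (cases "tl w = []")
      case True
      with w have "w = [\<mu>]" by (cases w) auto
      then show ?thesis by (auto intro!: exI[of _ 0])
    next
      case False
      \<comment> \<open>The last visit is sought in \<open>butlast w\<close>, since in
        \<open>w\<close> itself it would be the final vertex.\<close>
      with w have "w = butlast w @ [\<mu>]" "\<mu> \<in> set (butlast w)"
        by (cases w; auto)+
      then obtain p z where pz: "w = p @ \<mu> # z @ [\<mu>]" "\<mu> \<notin> set z"
        by (metis split_list_last append.assoc append_Cons)
      have p: "p @ [\<mu>] \<in> walks G \<mu> \<mu>"
        using w vwalk_append_iff[of "p @ [\<mu>]" "z @ [\<mu>]" G] pz(1)
        by (cases p) (auto simp: walks_def)
      then obtain i where i: "p @ [\<mu>] \<in> walk_power \<mu> E i"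
        using "1.IH" pz(1) by force
      have "vwalk (\<mu> # z @ [\<mu>]) G"
        using w(1) vwalk_append_iff[of p "\<mu> # z @ [\<mu>]" G] pz(1) by (cases "p = []") auto
      then have "\<mu> # z @ [\<mu>] \<in> E"
        using first_return pz(2) by (simp add: walks_def)
      moreover have "w = vwalk_join (p @ [\<mu>]) (\<mu> # z @ [\<mu>])"
        by (simp add: pz(1) vwalk_join_def)
      moreover have "joinable (p @ [\<mu>]) (\<mu> # z @ [\<mu>])" by (simp add: joinable_def)
      ultimately have "w \<in> walk_power \<mu> E (Suc i)"
        using i unfolding walk_power.simps concat_sets_def by blast
      then show ?thesis ..
    qed
  qed
  then show "walks G \<mu> \<mu> \<subseteq> kleene_star \<mu> E" by (auto simp: kleene_star_def)
qed

text \<open>The loop is covered by the second case with \<open>v = []\<close>; only the trivial walk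
  lacks a separate closing vertex.\<close>

lemma simple_cycles_cases:
  assumes "w \<in> simple_cycles G \<mu>"
  obtains "w = [\<mu>]" "\<mu> \<in> verts G"
  | v where "w = \<mu> # v @ [\<mu>]" "\<mu> \<notin> set v" "distinct v" "vwalk w G"
proof (cases "tl w = []")
  case True
  with assms have "w = [\<mu>]" "\<mu> \<in> verts G"
    by (cases w; auto simp: simple_cycles_def walks_def vwalk_def)+
  then show thesis using that by blast
next
  case False
  with assms have w: "w = \<mu> # butlast (tl w) @ [\<mu>]"
    by (cases w) (auto simp: simple_cycles_def walks_def)
  then have "butlast w = \<mu> # butlast (tl w)"
    by (metis butlast_append butlast_snoc append_Cons)
  with w assms show thesis
    by (intro that(2)[of "butlast (tl w)"]) (auto simp: simple_cycles_def walks_def)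
qed

text \<open>Each inner set \<open>A\<close> lives in a quiver with fewer vertices, where by
  induction its Kleene star consists of all cycles. So \<open>A_set G \<mu>\<close> lies between the
  first-return cycles and all cycles off \<mu>, which determines its star. Whether the trivial walk
  belongs to it makes no difference; with a loop at \<mu>, the terminating case omits it and the
  recursive case includes it.\<close>

lemma kleene_star_A_set:
  assumes "finite (verts G)" "\<mu> \<in> verts G"
  shows "kleene_star \<mu> (A_set G \<mu>) = walks G \<mu> \<mu>"
  using assms
proof (induction "card (verts G)" arbitrary: G \<mu> rule: less_induct)
  case less
  show ?case
  proof (cases "no_neighbour G \<mu>")
    case True
    have A: "A_set G \<mu> = (if (\<mu>, \<mu>) \<in> arcs_ends G then {[\<mu>, \<mu>]} else {[\<mu>]})"
      using True less.prems by (simp add: A_set.simps)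
    show ?thesis
    proof (rule kleene_star_eq_walks)
      show "A_set G \<mu> \<subseteq> walks G \<mu> \<mu>"
        using less.prems by (auto simp: A walks_def vwalk_def)
    next
      fix z assume z: "\<mu> # z @ [\<mu>] \<in> walks G \<mu> \<mu>" "\<mu> \<notin> set z"
      have "z = []"
      proof (rule ccontr)
        assume "z \<noteq> []"
        then have "hd z \<in> set z" by simp
        with z \<open>z \<noteq> []\<close> have "hd z \<in> verts G" "hd z \<noteq> \<mu>" "(\<mu>, hd z) \<in> arcs_ends G"
          by (auto simp: walks_def vwalk_def)
        with True show False by (auto simp: no_neighbour_def)
      qed
      with z show "\<mu> # z @ [\<mu>] \<in> A_set G \<mu>" by (auto simp: A walks_def vwalk_def)
    qed (use less.prems in simp)
  next
    case False
    define P where "P w = foldr (\<lambda>i S. S \<odot> kleene_star (w ! i)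
        (A_set (delete_verts G (set (take i w))) (w ! i))) [1..<length w - 1] {w}" for w
    have A: "A_set G \<mu> = (\<Union>w \<in> simple_cycles G \<mu>. P w)"
      using False less.prems by (simp add: A_set.simps[of G] P_def)
    have P: "P (\<mu> # v @ [\<mu>]) = (\<lambda>z. \<mu> # z @ [\<mu>]) ` detours G {\<mu>} v"
      if v: "\<mu> \<notin> set v" "distinct v" "vwalk (\<mu> # v @ [\<mu>]) G" for v
    proof -
      let ?w = "\<mu> # v @ [\<mu>]"
      \<comment> \<open>With \<open>u = t = [\<mu>]\<close> the range
        \<open>[1..<length w - 1]\<close> is exactly the block of positions of \<open>v\<close>;
        neither copy of \<mu> is nested into.\<close>
      have "foldr (\<lambda>i S. S \<odot> kleene_star (?w ! i) (A_set (delete_verts G (set (take i ?w))) (?w ! i)))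
          [length [\<mu>]..<length [\<mu>] + length v] {?w} = (\<lambda>z. [\<mu>] @ z @ [\<mu>]) ` detours G (set [\<mu>]) v"
      proof (rule foldr_nest_eq_detours)
        fix i assume i: "length [\<mu>] \<le> i" "i < length [\<mu>] + length v"
        let ?H = "delete_verts G (set (take i ?w))"
        have verts: "verts ?H = verts G - set (take i ?w)" by (simp add: delete_verts_def)
        have "\<mu> \<in> set (take i ?w)" using i by (cases i) auto
        then have "card (verts ?H) < card (verts G)"
          unfolding verts using less.prems by (intro psubset_card_mono) auto
        \<comment> \<open>Position \<open>i\<close> precedes the closing \<mu>, so the distinct list
          \<open>\<mu> # v\<close> can replace \<open>?w\<close>, and the vertex at \<open>i\<close>
          is not among the deleted ones.\<close>
        moreover have "?w ! i \<in> verts ?H"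
        proof -
          have "distinct (\<mu> # v)" "?w ! i = (\<mu> # v) ! i" "take i ?w = take i (\<mu> # v)"
            using v i by (auto simp: nth_append nth_Cons' take_Cons')
          moreover have "i < length (\<mu> # v)" using i by simp
          ultimately have "?w ! i \<notin> set (take i ?w)"
            by (metis id_take_nth_drop distinct_append distinct.simps(2) disjoint_iff
                list.set_intros(1))
          moreover have "?w ! i \<in> set ?w" using i by (intro nth_mem) simp
          ultimately show ?thesis using v(3) unfolding verts by (auto simp: vwalk_def)
        qed
        moreover have "finite (verts ?H)" using less.prems by (simp add: verts)
        ultimately show "kleene_star (?w ! i) (A_set ?H (?w ! i)) = walks ?H (?w ! i) (?w ! i)"
          using less.hyps by blast
      qed (use v in auto)
      then show ?thesis by (simp add: P_def)
    qed
    show ?thesis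
    proof (rule kleene_star_eq_walks)
      show "A_set G \<mu> \<subseteq> walks G \<mu> \<mu>"
      proof
        fix x assume "x \<in> A_set G \<mu>"
        then obtain w where w: "w \<in> simple_cycles G \<mu>" "x \<in> P w" unfolding A by blast
        from w(1) show "x \<in> walks G \<mu> \<mu>"
        proof (cases rule: simple_cycles_cases)
          \<comment> \<open>For the trivial walk the range is \<open>[1..<0]\<close>, so nothing is
            nested and \<open>P\<close> returns the singleton.\<close>
          case 1
          with w(2) show ?thesis by (simp add: P_def walks_def)
        next
          case (2 v)
          then obtain z where z: "x = \<mu> # z @ [\<mu>]" "z \<in> detours G {\<mu>} v"
            using w(2) P[of v] by auto
          show ?thesis
          proof (cases "v = []")
            case True
            with 2 z show ?thesis by (simp add: walks_def)
          next
            case False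
            have "vwalk v G" "(\<mu>, hd v) \<in> arcs_ends G" "(last v, \<mu>) \<in> arcs_ends G" "\<mu> \<in> verts G"
              using 2 False by (auto simp: vwalk_Cons_iff vwalk_append_iff)
            moreover from this 2 have "z \<in> walks (delete_verts G {\<mu>}) (hd v) (last v)"
              using detours_subset_walks[of v G "{\<mu>}"] z(2) by auto
            moreover from this have "z \<noteq> []" by (simp add: walks_nonempty)
            ultimately show ?thesis
              by (auto simp: z(1) walks_def vwalk_Cons_iff vwalk_append_iff)
          qed
        qed
      qed
    next
      fix z assume z: "\<mu> # z @ [\<mu>] \<in> walks G \<mu> \<mu>" "\<mu> \<notin> set z"
      show "\<mu> # z @ [\<mu>] \<in> A_set G \<mu>"
      proof (cases "z = []")
        case True
        with z have "\<mu> # [] @ [\<mu>] \<in> simple_cycles G \<mu>" "P (\<mu> # [] @ [\<mu>]) = {[\<mu>, \<mu>]}"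
          by (auto simp: simple_cycles_def P_def)
        with True show ?thesis unfolding A by force
      next
        case False
        then have arcs: "(\<mu>, hd z) \<in> arcs_ends G" "(last z, \<mu>) \<in> arcs_ends G"
          "z \<in> walks (delete_verts G {\<mu>}) (hd z) (last z)"
          using z by (auto simp: walks_def vwalk_Cons_iff vwalk_append_iff)
        obtain v where v: "v \<in> simple_paths (delete_verts G {\<mu>}) (hd z) (last z)"
          "z \<in> detours G {\<mu>} v"
          using walks_subset_detours[OF arcs(3)] by blast
        from v(1) have "v \<noteq> []" by (auto simp: simple_paths_def dest: walks_nonempty)
        with v(1)
        have v': "vwalk v G" "hd v = hd z" "last v = last z" "distinct v" "\<mu> \<notin> set v" "v \<noteq> []"
          by (simp_all add: simple_paths_def walks_def vpath_def)
        \<comment> \<open>The path \<open>v\<close> has the same end vertices as \<open>z\<close>,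
          so the arcs joining \<open>z\<close> to \<mu> also close \<open>v\<close> to a simple
          cycle.\<close>
        have "vwalk (\<mu> # v @ [\<mu>]) G"
          using v' arcs less.prems by (simp add: vwalk_Cons_iff vwalk_append_iff)
        moreover from this v' have "\<mu> # v @ [\<mu>] \<in> simple_cycles G \<mu>"
          by (auto simp: simple_cycles_def walks_def butlast_append)
        ultimately show ?thesis
          using P[of v] v' v(2) unfolding A by blast
      qed
    qed (use less.prems in simp)
  qed
qed

section \<open>Factorization of all walks\<close>

lemma path_product_eq_detours:
  assumes "finite (verts G)" "vpath w G"
  shows "path_product G w = detours G {} w"
proof -
  let ?H = "\<lambda>i. delete_verts G (set (take i w))"
  have "kleene_star (w ! i) (A_set (?H i) (w ! i)) = walks (?H i) (w ! i) (w ! i)"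
    if i: "i < length w" for i
  proof (rule kleene_star_A_set)
    have "w ! i \<notin> set (take i w)"
      using assms(2) i
      by (metis vpath_def id_take_nth_drop distinct_append disjoint_iff list.set_intros(1))
    moreover have "w ! i \<in> verts G" using assms(2) i by (auto simp: vpath_def vwalk_def)
    ultimately show "w ! i \<in> verts (?H i)" by (simp add: delete_verts_def)
  qed (use assms(1) in \<open>simp add: delete_verts_def\<close>)
  \<comment> \<open>The frame is empty here: unlike for a simple cycle, cycles are nested at every
    vertex, the end vertices included.\<close>
  then show ?thesis
    using foldr_nest_eq_detours[of w "[]" w "[]"
        "\<lambda>i. kleene_star (w ! i) (A_set (?H i) (w ! i))" G] assms(2)
    by (simp add: path_product_def vpath_def)
qed

lemma walks_eq_UN_path_product:
  assumes "finite (verts G)"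
  shows "walks G \<alpha> \<omega> = (\<Union>w \<in> simple_paths G \<alpha> \<omega>. path_product G w)"
proof -
  have "walks G \<alpha> \<omega> = (\<Union>w \<in> simple_paths G \<alpha> \<omega>. detours G {} w)"
    \<comment> \<open>For an arbitrary \<open>pre_digraph\<close>, \<open>delete_verts G {}\<close>
      may differ from \<open>G\<close>, but it has the same walks and simple paths.\<close>
    using walks_eq_UN_detours[of G "{}"]
    by (simp add: walks_delete_verts simple_paths_delete_verts)
  also have "\<dots> = (\<Union>w \<in> simple_paths G \<alpha> \<omega>. path_product G w)"
    using assms by (intro SUP_cong) (auto simp: path_product_eq_detours simple_paths_def)
  finally show ?thesis .
qed

lemma simple_paths_same:
  assumes "\<alpha> \<in> verts G"
  shows "simple_paths G \<alpha> \<alpha> = {[\<alpha>]}"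
proof (intro equalityI subsetI)
  fix w assume w: "w \<in> simple_paths G \<alpha> \<alpha>"
  then show "w \<in> {[\<alpha>]}"
    by (cases w) (auto simp: simple_paths_def walks_def vpath_def vwalk_def split: if_splits)
qed (use assms in \<open>auto simp: simple_paths_def walks_def vpath_def\<close>)

theorem theorem2:
  fixes G :: "('a, 'b) pre_digraph"
  assumes "fin_digraph G" and "nomulti_digraph G"
  shows "(\<forall>\<alpha> \<in> verts G. \<forall>\<omega> \<in> verts G.
            walks G \<alpha> \<omega> = (\<Union>w \<in> simple_paths G \<alpha> \<omega>. path_product G w))
       \<and> (\<forall>\<alpha> \<in> verts G. simple_paths G \<alpha> \<alpha> = {[\<alpha>]}
            \<and> walks G \<alpha> \<alpha> = kleene_star \<alpha> (A_set G \<alpha>))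
       \<and> all_walks G =
            (\<Union>\<alpha> \<in> verts G. \<Union>\<omega> \<in> verts G. \<Union>w \<in> simple_paths G \<alpha> \<omega>. path_product G w)"
proof -
  have fin: "finite (verts G)" using assms(1) by (rule fin_digraph.finite_verts)
  have "all_walks G = (\<Union>\<alpha> \<in> verts G. \<Union>\<omega> \<in> verts G. walks G \<alpha> \<omega>)"
  proof -
    have "hd w \<in> verts G" "last w \<in> verts G" if "vwalk w G" for w
      using that hd_in_set[of w] last_in_set[of w] by (blast dest: vwalkE)+
    then show ?thesis by (auto simp: all_walks_def walks_def)
  qed
  \<comment> \<open>Read from right to left, the product formula turns the unions back into sets of
    walks; the claim on cycles comes from \<open>kleene_star_A_set\<close>.\<close>
  with fin show ?thesis
    by (simp add: walks_eq_UN_path_product[symmetric] simple_paths_same kleene_star_A_set)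
qed

end
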